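(* Let $q$ be a prime power, $n\ge1$ and $r\ge1$. Suppose there exists a partial $(r-1)$-spread of $\mathrm{PG}(n-1,q^2)$ of size $N$. Then there exists a constant rank-distance $k=2r$ set in $H_n(\mathbb{F}_{q^2})$ of size $N$.
   Context: A partial $(r-1)$-spread of $\mathrm{PG}(n-1,q^2)$ is a set of pairwise disjoint $(r-1)$-dimensional projective subspaces (i.e. $r$-dimensional vector subspaces of $\mathbb{F}_{q^2}^n$ pairwise intersecting trivially). $H_n(\mathbb{F}_{q^2})$ is the set of $n\times n$ hermitian matrices over $\mathbb{F}_{q^2}$ (matrices $A$ with $\overline{A}^T=A$, $\overline{\cdot}$ being $x\mapsto x^q$ entrywise). A constant rank-distance $k$ set is a set $U$ of $n\times n$ matrices with $\mathrm{rank}(A-B)=k$ for all distinct $A,B\in U$ and $\mathrm{rank}(A)=k$ for all nonzero $A\in U$. *)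

theory Defs
  imports "HOL-Analysis.Analysis" "HOL-Number_Theory.Prime_Powers"
begin

text \<open>
  Throughout, the ambient space of dimension \<open>n = CARD('n) \<ge> 1\<close> over the field \<open>'a\<close> is the type
  \<open>'a ^ 'n\<close>; its linear-algebra notions are those of the locale interpretation \<open>vec\<close>.
\<close>

text \<open>The index \<open>d\<close> is the projective dimension of the elements, hence \<open>Suc d\<close> below.\<close>

definition partial_spread :: "nat \<Rightarrow> ('a::field ^ 'n) set set \<Rightarrow> bool" where
  "partial_spread d S \<longleftrightarrow>
     (\<forall>W\<in>S. vec.subspace W \<and> vec.dim W = Suc d) \<and>
     pairwise (\<lambda>V W. V \<inter> W = {0}) S"

text \<open>
  The conjugation is entrywise \<open>x \<mapsto> x ^ q\<close>; it is the involution of the hermitian setting only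
  when \<open>CARD('a) = q\<^sup>2\<close>.
\<close>

definition hermitian_matrices :: "nat \<Rightarrow> ('a::field ^ 'n ^ 'n) set" where
  "hermitian_matrices q = {A. transpose (map_matrix (\<lambda>x. x ^ q) A) = A}"

definition constant_rank_distance :: "nat \<Rightarrow> ('a::field ^ 'n ^ 'n) set \<Rightarrow> bool" where
  "constant_rank_distance k U \<longleftrightarrow>
     (\<forall>A\<in>U. \<forall>B\<in>U. A \<noteq> B \<longrightarrow> rank (A - B) = k) \<and>
     (\<forall>A\<in>U. A \<noteq> 0 \<longrightarrow> rank A = k)"

end

theory Submission
  imports Defs "HOL-Number_Theory.Residues"
begin

text \<open>
  Choose a basis of every spread element \<open>W\<close> and let \<open>H\<^sub>W\<close> be the sum of the hermitian rank-one
  matrices \<open>b b\<^sup>*\<close> over the basis vectors \<open>b\<close>. If \<open>V\<close> and \<open>W\<close> intersect trivially, the two bases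
  form an independent set, so \<open>H\<^sub>V - H\<^sub>W\<close> is a combination of \<open>2 * r\<close> such rank-one matrices with
  nonzero coefficients and has rank \<open>2 * r\<close>. As nonzero elements must also have rank \<open>2 * r\<close>, and
  \<open>H\<^sub>W\<close> only has rank \<open>r\<close>, the family is translated by one fixed \<open>H\<^sub>W\<close>, which becomes \<open>0\<close>.
\<close>

text \<open>A vanishing combination over the union splits into a vector of one span and its negative
  in the other. Both then lie in the trivial intersection, and each independence applies separately.
  A common member of \<open>B\<close> and \<open>C\<close> would have to be 0.\<close>

lemma (in vector_space) independent_Un:
  assumes fin: "finite B" "finite C"
    and ind: "independent B" "independent C"
    and triv: "span B \<inter> span C = {0}"
  shows "independent (B \<union> C)" and "B \<inter> C = {}"
proof -
  have nz: "x \<noteq> 0" if "x \<in> B" for x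
    using that ind dependent_zero by blast
  show disj: "B \<inter> C = {}"
    using nz triv span_base by blast
  have "\<forall>v\<in>B \<union> C. u v = 0" if u: "(\<Sum>v\<in>B \<union> C. u v *s v) = 0" for u
  proof -
    let ?s = "\<Sum>v\<in>B. u v *s v" and ?t = "\<Sum>v\<in>C. u v *s v"
    have sum0: "?s + ?t = 0"
      using u fin disj by (simp add: sum.union_disjoint)
    have sB: "?s \<in> span B" and tC: "?t \<in> span C"
      by (intro span_sum span_scale span_base; assumption)+
    have "?s = - ?t"
      using sum0 by (simp add: eq_neg_iff_add_eq_0)
    then have "?s \<in> span C"
      using tC by (simp add: span_neg)
    with sB triv have s0: "?s = 0"
      by blast
    with sum0 have t0: "?t = 0"
      by simp
    show ?thesis
      using independentD[OF ind(1) fin(1) subset_refl s0]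
        independentD[OF ind(2) fin(2) subset_refl t0] by blast
  qed
  then show "independent (B \<union> C)"
    using fin by (subst dependent_finite) auto
qed

lemma rank_sum_outer_products:
  fixes B :: "('a::field ^ 'm) set" and g :: "'a ^ 'm \<Rightarrow> 'a ^ 'n"
  assumes B: "vec.independent B"
    and g: "inj_on g B" "vec.independent (g ` B)"
    and c: "\<And>b. b \<in> B \<Longrightarrow> c b \<noteq> 0"
  shows "rank (\<chi> i j. \<Sum>b\<in>B. c b * b $ i * g b $ j) = card B"
proof -
  define M where "M = (\<chi> i j. \<Sum>b\<in>B. c b * b $ i * g b $ j)"
  have fin: "finite B"
    using B by (rule vec.finiteI_independent)
  have row: "row i M = (\<Sum>b\<in>B. (c b * b $ i) *s g b)" for i
    by (simp add: M_def row_def vec_eq_iff sum_component)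
  have "rows M \<subseteq> vec.span (g ` B)"
    unfolding rows_def row
    by (auto intro: vec.span_sum vec.span_scale vec.span_base)
  moreover have "g b \<in> vec.span (rows M)" if b: "b \<in> B" for b
  proof -
    \<comment> \<open>\<open>F\<close> is the functional dual to \<open>b\<close> on
      \<open>B\<close>, with scalars written as vectors of length 1. Its coordinates
      \<open>w\<close> serve as weights for the rows.\<close>
    obtain F :: "'a ^ 'm \<Rightarrow> 'a ^ 1"
      where lin: "Vector_Spaces.linear (*s) (*s) F"
        and F: "\<And>x. x \<in> B \<Longrightarrow> F x = (if x = b then 1 else 0)"
      using vec.linear_independent_extend[OF B, of "\<lambda>x. if x = b then 1 else 0"] by metis
    define w where "w i = F (axis i 1) $ 1" for i
    have F_eq: "(\<Sum>i\<in>UNIV. x $ i * w i) = F x $ 1" for x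
    proof -
      have "F x = F (\<Sum>i\<in>UNIV. x $ i *s axis i 1)"
        by (simp add: basis_expansion)
      also have "\<dots> = (\<Sum>i\<in>UNIV. x $ i *s F (axis i 1))"
        by (simp add: vec.linear_sum[OF lin] vec.linear_scale[OF lin])
      finally show ?thesis
        by (simp add: w_def sum_component)
    qed
    have "(\<Sum>i\<in>UNIV. w i *s row i M) = (\<Sum>i\<in>UNIV. \<Sum>x\<in>B. (c x * (x $ i * w i)) *s g x)"
      by (simp add: row vec.scale_sum_right mult_ac)
    also have "\<dots> = (\<Sum>x\<in>B. (c x * F x $ 1) *s g x)"
      by (subst sum.swap) (simp flip: F_eq vec.scale_sum_left sum_distrib_left)
    also have "\<dots> = (\<Sum>x\<in>B. if x = b then c b *s g b else 0)"
      by (rule sum.cong) (auto simp: F)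
    also have "\<dots> = c b *s g b"
      using fin b by simp
    finally have "g b = inverse (c b) *s (\<Sum>i\<in>UNIV. w i *s row i M)"
      using c[OF b] by simp
    also have "\<dots> \<in> vec.span (rows M)"
      by (intro vec.span_scale vec.span_sum vec.span_base) (auto simp: rows_def)
    finally show ?thesis .
  qed
  ultimately have "vec.span (rows M) = vec.span (g ` B)"
    by (intro vec.span_eq[THEN iffD2] conjI) auto
  then have "vec.dim (rows M) = vec.dim (g ` B)"
    by (metis vec.dim_span)
  also have "\<dots> = card B"
    using g by (simp add: vec.dim_eq_card_independent card_image)
  finally show ?thesis
    by (simp add: row_rank_def_gen M_def)
qed

text \<open>Multiplication by a nonzero \<open>x\<close> permutes the nonzero elements, so their
  product, itself nonzero, is unchanged by the factor \<open>x ^ (CARD('a) - 1)\<close>.\<close>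

lemma power_CARD_eq_same:
  fixes x :: "'a::{field,finite}"
  shows "x ^ CARD('a) = x"
proof (cases "x = 0")
  case False
  let ?P = "\<Prod>y\<in>- {0 :: 'a}. y"
  have "bij_betw ((*) x) (- {0}) (- {0})"
    by (rule bij_betwI[of _ _ _ "\<lambda>y. y / x"]) (use False in auto)
  then have "?P = (\<Prod>y\<in>- {0}. x * y)"
    by (rule prod.reindex_bij_betw[symmetric])
  also have "\<dots> = x ^ (CARD('a) - 1) * ?P"
    by (simp add: prod.distrib Compl_eq_Diff_UNIV card_Diff_singleton)
  finally have "x ^ (CARD('a) - 1) = 1"
    by simp
  then have "x * x ^ (CARD('a) - 1) = x"
    by simp
  then show ?thesis
    by (metis One_nat_def Suc_pred power_Suc zero_less_card_finite)
qed simp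

lemma rank_zero: "rank (0 :: 'a::field ^ 'n ^ 'm) = 0"
proof -
  have "rows (0 :: 'a ^ 'n ^ 'm) = {0}"
    by (auto simp: rows_def row_def vec_eq_iff)
  then show ?thesis
    by (simp add: row_rank_def_gen)
qed

context
  fixes q :: nat
  assumes q: "primepow q" and card_a: "CARD('a::{field,finite}) = q ^ 2"
begin

text \<open>The characteristic is a prime dividing the order \<open>q ^ 2\<close>, hence the prime
  of which \<open>q\<close> is a power. This makes the conjugation an iterated Frobenius map and so
  additive.\<close>

lemma q_power_of_CHAR: "\<exists>k. q = CHAR('a) ^ k"
proof -
  obtain p k where pk: "prime p" "q = p ^ k"
    using q by (auto simp: primepow_def)
  have pr: "prime CHAR('a)"
    by (rule prime_CHAR_semidom) (simp add: finite_imp_CHAR_pos)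
  have "CHAR('a) dvd p ^ (k * 2)"
    using CHAR_dvd_CARD[where 'a='a] card_a pk by (simp add: power_mult)
  then have "CHAR('a) dvd p"
    using pr prime_dvd_power by blast
  then show ?thesis
    using pr pk by (metis primes_dvd_imp_eq)
qed

lemma sum_power_q: "(sum f A) ^ q = (\<Sum>x\<in>A. (f x :: 'a) ^ q)"
proof -
  have "prime CHAR('a)"
    by (rule prime_CHAR_semidom) (simp add: finite_imp_CHAR_pos)
  with q_power_of_CHAR show ?thesis
    using freshmans_dream_sum' by metis
qed

lemma power_q_power_q [simp]: "((x :: 'a) ^ q) ^ q = x"
  using power_CARD_eq_same[of x] card_a
  by (simp add: power_mult[symmetric] power2_eq_square)

definition conj_vec :: "'a ^ 'n \<Rightarrow> 'a ^ 'n" where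
  "conj_vec x = (\<chi> i. x $ i ^ q)"

lemma inj_conj_vec: "inj conj_vec"
  unfolding conj_vec_def by (rule injI) (metis power_q_power_q vec_eq_iff vec_lambda_beta)

text \<open>Conjugation is only semilinear: raising each coordinate of a relation among the
  conjugates to the power \<open>q\<close> gives a relation among the members of \<open>B\<close>,
  with conjugated coefficients.\<close>

lemma independent_conj_vec:
  assumes B: "vec.independent B"
  shows "vec.independent (conj_vec ` B)"
proof -
  have fin: "finite B"
    using B by (rule vec.finiteI_independent)
  have "u (conj_vec v) = 0" if u: "(\<Sum>b\<in>B. u (conj_vec b) *s conj_vec b) = 0" and v: "v \<in> B" for u v
  proof -
    have q0: "q > 0"
      using q by (simp add: primepow_gt_0_nat)
    have "(\<Sum>b\<in>B. (u (conj_vec b) ^ q) * b $ i) = 0" for i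
    proof -
      have "(\<Sum>b\<in>B. u (conj_vec b) * b $ i ^ q) = 0"
        using arg_cong[OF u, of "\<lambda>x. x $ i"] by (simp add: conj_vec_def sum_component)
      then have "(\<Sum>b\<in>B. u (conj_vec b) * b $ i ^ q) ^ q = 0"
        using q0 by simp
      then show ?thesis
        by (simp add: sum_power_q power_mult_distrib)
    qed
    then have "(\<Sum>b\<in>B. (u (conj_vec b) ^ q) *s b) = 0"
      by (simp add: vec_eq_iff sum_component)
    from vec.independentD[OF B fin subset_refl this v] show ?thesis
      by simp
  qed
  then show ?thesis
    using fin
    by (subst vec.dependent_finite)
      (auto simp: sum.reindex[OF inj_on_subset[OF inj_conj_vec subset_UNIV]])
qed

text \<open>If the members of \<open>B\<close> are the columns of \<open>X\<close>, this is
  \<open>X X\<^sup>*\<close>. The argument is a basis because the matrix can change with the basis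
  of a fixed subspace.\<close>

definition hermitian_sum :: "('a ^ 'n) set \<Rightarrow> 'a ^ 'n ^ 'n" where
  "hermitian_sum B = (\<chi> i j. \<Sum>b\<in>B. b $ i * b $ j ^ q)"

lemma hermitian_sum_in: "hermitian_sum B \<in> hermitian_matrices q"
  by (simp add: hermitian_matrices_def hermitian_sum_def vec_eq_iff transpose_def sum_power_q
      power_mult_distrib mult.commute)

lemma hermitian_matrices_diff:
  assumes "A \<in> hermitian_matrices q" "B \<in> hermitian_matrices q"
  shows "(A - B :: 'a ^ 'n ^ 'n) \<in> hermitian_matrices q"
proof -
  have diff: "(x - y) ^ q = x ^ q - y ^ q" for x y :: 'a
    \<comment> \<open>Writing \<open>x\<close> as the two-term sum of \<open>x - y\<close> and
      \<open>y\<close>, indexed by \<open>bool\<close>, avoids computing the sign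
      \<open>(- 1) ^ q\<close>.\<close>
    using sum_power_q[of "\<lambda>b. if b then x - y else y" UNIV]
    by (simp add: UNIV_bool algebra_simps)
  show ?thesis
    using assms by (simp add: hermitian_matrices_def vec_eq_iff transpose_def diff)
qed

lemma rank_hermitian_sum_diff:
  assumes ind: "vec.independent B" "vec.independent C"
    and triv: "vec.span B \<inter> vec.span C = {0}"
  shows "rank (hermitian_sum B - hermitian_sum C) = card B + card C"
proof -
  have fin: "finite B" "finite C"
    using ind by (auto intro: vec.finiteI_independent)
  note un = vec.independent_Un[OF fin ind triv]
  \<comment> \<open>Both values are nonzero in every field, including characteristic 2, where they
    coincide.\<close>
  let ?c = "\<lambda>b. if b \<in> B then 1 else - 1 :: 'a"
  have "hermitian_sum B - hermitian_sum C
      = (\<chi> i j. \<Sum>b\<in>B \<union> C. ?c b * b $ i * conj_vec b $ j)"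
  proof -
    have "(\<Sum>b\<in>C. ?c b * b $ i * conj_vec b $ j) = (\<Sum>b\<in>C. - (b $ i * b $ j ^ q))" for i j
      using un(2) by (intro sum.cong) (auto simp: conj_vec_def)
    moreover have "(\<Sum>b\<in>B. ?c b * b $ i * conj_vec b $ j) = (\<Sum>b\<in>B. b $ i * b $ j ^ q)" for i j
      by (intro sum.cong) (auto simp: conj_vec_def)
    ultimately show ?thesis
      using fin un(2)
      by (simp add: vec_eq_iff hermitian_sum_def sum.union_disjoint sum_negf)
  qed
  also have "rank \<dots> = card (B \<union> C)"
    using un(1) independent_conj_vec[OF un(1)] inj_on_subset[OF inj_conj_vec subset_UNIV]
    by (intro rank_sum_outer_products) auto
  also have "\<dots> = card B + card C"
    using fin un(2) by (rule card_Un_disjoint)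
  finally show ?thesis .
qed

lemma constant_rank_distance_of_partial_spread:
  assumes S: "partial_spread d (S :: ('a ^ 'n) set set)"
  shows "\<exists>U :: ('a ^ 'n ^ 'n) set. U \<subseteq> hermitian_matrices q \<and>
    constant_rank_distance (2 * Suc d) U \<and> card U = card S"
proof (cases "S = {}")
  \<comment> \<open>The translation below needs some spread element, so the empty spread is treated
    apart.\<close>
  case True
  then show ?thesis
    by (intro exI[of _ "{}"]) (simp add: constant_rank_distance_def)
next
  case False
  then obtain W\<^sub>0 where W\<^sub>0: "W\<^sub>0 \<in> S"
    by blast
  have "\<exists>B. vec.independent B \<and> vec.span B = W \<and> card B = Suc d" if "W \<in> S" for W
  proof -
    have W: "vec.subspace W" "vec.dim W = Suc d"
      using S that by (auto simp: partial_spread_def)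
    obtain B where "B \<subseteq> W" "vec.independent B" "W \<subseteq> vec.span B" "card B = vec.dim W"
      using vec.basis_exists by blast
    with W show ?thesis
      by (metis vec.span_minimal subset_antisym)
  qed
  then obtain basis where basis: "\<And>W. W \<in> S \<Longrightarrow>
      vec.independent (basis W) \<and> vec.span (basis W) = W \<and> card (basis W) = Suc d"
    by metis
  define H where "H W = hermitian_sum (basis W) - hermitian_sum (basis W\<^sub>0)" for W
  have rank_diff: "rank (H V - H W) = 2 * Suc d" if "V \<in> S" "W \<in> S" "V \<noteq> W" for V W
  proof -
    have "V \<inter> W = {0}"
      using S that by (auto simp: partial_spread_def pairwise_def)
    \<comment> \<open>The translation by \<open>hermitian_sum (basis W\<^sub>0)\<close> cancels in
      \<open>H V - H W\<close>.\<close>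
    then show ?thesis
      using rank_hermitian_sum_diff[of "basis V" "basis W"] basis that by (simp add: H_def)
  qed
  have "H W\<^sub>0 = 0"
    by (simp add: H_def)
  \<comment> \<open>A nonzero \<open>H W\<close> has \<open>W \<noteq> W\<^sub>0\<close> and is its
    own difference from \<open>H W\<^sub>0 = 0\<close>.\<close>
  then have rank_H: "rank (H W) = 2 * Suc d" if "W \<in> S" "H W \<noteq> 0" for W
    using rank_diff[of W W\<^sub>0] that W\<^sub>0 by auto
  have "inj_on H S"
  proof (rule inj_onI, rule ccontr)
    fix V W assume "V \<in> S" "W \<in> S" "H V = H W" "V \<noteq> W"
    then show False
      \<comment> \<open>Equal images would give a difference of rank 0, but \<open>2 * Suc d\<close>
        is positive.\<close>
      using rank_diff[of V W] by (simp add: rank_zero)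
  qed
  then have "card (H ` S) = card S"
    by (rule card_image)
  moreover have "constant_rank_distance (2 * Suc d) (H ` S)"
    unfolding constant_rank_distance_def using rank_diff rank_H by blast
  moreover have "H ` S \<subseteq> hermitian_matrices q"
    by (auto simp: H_def intro!: hermitian_matrices_diff hermitian_sum_in)
  ultimately show ?thesis
    by blast
qed

end

theorem theorem6p1:
  fixes q r N :: nat
    and S :: "('a::{field,finite} ^ 'n) set set"
  assumes "primepow q"
    and "CARD('a) = q ^ 2"
    and "r \<ge> 1"
    and "partial_spread (r - 1) S"
    and "card S = N"
  shows "\<exists>U :: ('a ^ 'n ^ 'n) set.
           U \<subseteq> hermitian_matrices q \<and> constant_rank_distance (2 * r) U \<and> card U = N"
  \<comment> \<open>The bound \<open>r \<ge> 1\<close> turns \<open>Suc (r - 1)\<close> back into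
    \<open>r\<close>.\<close>
  using constant_rank_distance_of_partial_spread[OF assms(1,2,4)] assms(3,5) by simp

end
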